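(* The delayed LWR model $$\partial_t\rho(x,t)+\partial_x\big(\rho(x,t)\,V(\rho(x,t-T))\big)=0$$ conserves the quantity $\rho(x,t)$. That is, for every space interval $[a,b]$, $$\frac{d}{dt}\int_a^b\rho(x,t)\,dx=\rho(a,t)\,V(\rho(a,t-T))-\rho(b,t)\,V(\rho(b,t-T)),$$ so the amount of density in $[a,b]$ changes only due to the flux at the boundaries $a$ and $b$.
   Context: Here $\rho=\rho(x,t)$ is the traffic density at the point $x\in\mathbb{R}$ at time $t>0$, the velocity $V=V(\rho)$ is a given function of the density, and $T\ge0$ is the time delay. For $T=0$ the equation is the classical Lighthill-Whitham-Richards (LWR) model. The initial data is an initial history function, prescribing $\rho(x,t)$ for $x\in\mathbb{R}$ and $t\in[-T,0]$. *)

theory Defs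
  imports "HOL-Analysis.Analysis"
begin

definition delayed_flux :: "(real \<Rightarrow> real) \<Rightarrow> real \<Rightarrow> (real \<Rightarrow> real \<Rightarrow> real) \<Rightarrow> real \<Rightarrow> real \<Rightarrow> real" where
  "delayed_flux V T \<rho> x t = \<rho> x t * V (\<rho> x (t - T))"

text \<open>
  Classical solutions, with \<open>\<rho> x t\<close> the density at position \<open>x\<close> and time \<open>t\<close>. Only the values
  for \<open>t \<ge> - T\<close> matter; those on \<open>[- T, 0]\<close> are the initial history \<open>\<phi>\<close>. The regularity required
  for \<open>t > 0\<close> is no more than a classical reading of the equation needs: \<open>\<rho>\<close> and its time
  derivative are jointly continuous, and the flux as a whole is differentiable in space. So neither
  \<open>V\<close> nor \<open>\<phi>\<close> has to be smooth on its own, and no continuity across \<open>t = 0\<close> is imposed;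
  \<open>C\<^sup>1\<close> solutions with \<open>C\<^sup>1\<close> velocity and history are a special case.
\<close>
definition delayed_LWR_solution ::
    "(real \<Rightarrow> real) \<Rightarrow> real \<Rightarrow> (real \<Rightarrow> real \<Rightarrow> real) \<Rightarrow> (real \<Rightarrow> real \<Rightarrow> real) \<Rightarrow> bool" where
  "delayed_LWR_solution V T \<phi> \<rho> \<longleftrightarrow>
     (\<forall>x. \<forall>t\<in>{- T..0}. \<rho> x t = \<phi> x t) \<and>
     continuous_on (UNIV \<times> {0<..}) (\<lambda>(x, t). \<rho> x t) \<and>
     continuous_on (UNIV \<times> {0<..}) (\<lambda>(x, t). deriv (\<lambda>s. \<rho> x s) t) \<and>
     (\<forall>x. \<forall>t>0.
        (\<lambda>s. \<rho> x s) differentiable (at t) \<and>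
        (\<lambda>y. delayed_flux V T \<rho> y t) differentiable (at x) \<and>
        deriv (\<lambda>s. \<rho> x s) t + deriv (\<lambda>y. delayed_flux V T \<rho> y t) x = 0)"

end

theory Submission
  imports Defs
begin

text \<open>
  Differentiate under the integral sign, replace the time derivative of the density by minus the
  space derivative of the flux, and integrate the latter by the fundamental theorem of calculus.
\<close>

theorem lemma2p1:
  fixes V :: "real \<Rightarrow> real" and T :: real
    and \<phi> \<rho> :: "real \<Rightarrow> real \<Rightarrow> real"
    and a b t :: real
  assumes "T \<ge> 0"
    and "delayed_LWR_solution V T \<phi> \<rho>"
    and "a \<le> b" and "t > 0"
  shows "((\<lambda>s. integral {a..b} (\<lambda>x. \<rho> x s)) has_real_derivative
           (\<rho> a t * V (\<rho> a (t - T)) - \<rho> b t * V (\<rho> b (t - T)))) (at t)"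
proof -
  let ?F = "\<lambda>y. delayed_flux V T \<rho> y t"
  let ?\<rho>t = "\<lambda>x s. deriv (\<lambda>s. \<rho> x s) s"
  have cont: "continuous_on (UNIV \<times> {0<..}) (\<lambda>(x, t). \<rho> x t)"
    and cont_deriv: "continuous_on (UNIV \<times> {0<..}) (\<lambda>(x, t). ?\<rho>t x t)"
    and diff_time: "\<And>x s. s > 0 \<Longrightarrow> (\<lambda>s. \<rho> x s) differentiable (at s)"
    and diff_flux: "\<And>x. ?F differentiable (at x)"
    and pde: "\<And>x. ?\<rho>t x t + deriv ?F x = 0"
    using assms(2) \<open>t > 0\<close> by (auto simp: delayed_LWR_solution_def)
  \<comment> \<open>The half-line \<open>{0<..}\<close> serves as the parameter set: it is convex,
    as the Leibniz rule demands, and it is where the solution is regular.\<close>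
  have leibniz: "((\<lambda>s. integral (cbox a b) (\<lambda>x. \<rho> x s)) has_field_derivative
      integral (cbox a b) (\<lambda>x. ?\<rho>t x t)) (at t within {0<..})"
  proof (rule leibniz_rule_field_derivative[where U = "{0<..}"])
    show "((\<lambda>s. \<rho> x s) has_field_derivative ?\<rho>t x s) (at s within {0<..})"
      if "s \<in> {0<..}" for s x
      using diff_time[of s x] that
      by (simp add: DERIV_deriv_iff_real_differentiable has_field_derivative_at_within)
    show "(\<lambda>x. \<rho> x s) integrable_on cbox a b" if "s \<in> {0<..}" for s
    proof (rule integrable_continuous)
      have "continuous_on (cbox a b) (\<lambda>x. (x, s))"
        by (intro continuous_intros)
      from continuous_on_compose2[OF cont this] that
      show "continuous_on (cbox a b) (\<lambda>x. \<rho> x s)"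
        by (simp add: image_subset_iff)
    qed
    \<comment> \<open>The rule takes the parameter, here time, as first coordinate, whereas
      \<open>cont_deriv\<close> has space first; composing with the swap reconciles the two.\<close>
    have "continuous_on ({0<..} \<times> cbox a b) (\<lambda>p. (snd p, fst p))"
      by (intro continuous_intros)
    from continuous_on_compose2[OF cont_deriv this]
    show "continuous_on ({0<..} \<times> cbox a b) (\<lambda>(s, x). ?\<rho>t x s)"
      by (simp add: case_prod_unfold image_subset_iff)
  qed (use \<open>t > 0\<close> in auto)
  \<comment> \<open>The gauge integral integrates every derivative, so pointwise differentiability
    of the flux in space suffices here.\<close>
  have "((\<lambda>x. - ?\<rho>t x t) has_integral ?F b - ?F a) {a..b}"
  proof (rule fundamental_theorem_of_calculus[OF \<open>a \<le> b\<close>])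
    fix x
    have "(?F has_real_derivative deriv ?F x) (at x)"
      using diff_flux DERIV_deriv_iff_real_differentiable by blast
    moreover have "deriv ?F x = - ?\<rho>t x t"
      using pde[of x] by linarith
    ultimately show "(?F has_vector_derivative - ?\<rho>t x t) (at x within {a..b})"
      by (simp add: has_real_derivative_iff_has_vector_derivative has_vector_derivative_at_within)
  qed
  \<comment> \<open>Negating both sides gives the sign of the balance: inflow at \<open>a\<close>
    minus outflow at \<open>b\<close>.\<close>
  from integral_unique[OF has_integral_neg[OF this]]
  have "integral {a..b} (\<lambda>x. ?\<rho>t x t) = ?F a - ?F b"
    by simp
  \<comment> \<open>As \<open>{0<..}\<close> is an open set containing \<open>t\<close>, the
    derivative within it is the two-sided one.\<close>
  with leibniz show ?thesis
    using \<open>t > 0\<close> by (simp add: at_within_open[of t "{0<..}"] delayed_flux_def)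
qed

end
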